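(* Let $q \ge 2$, $n \ge 1$, $\nu$ and $k$ be integers with $1 \le \nu \le n$ and $0 \le k \le n$. Then $$\sum_{i=1}^{\nu} (q^i-1)\binom{\nu}{i}\binom{n-\nu}{k-i} = \sum_{i=1}^{\nu} (q-1)^i \binom{\nu}{i}\binom{n-i}{k-i}.$$
   Context: Convention: for integers $m \ge 0$ and $j$, $\binom{m}{j}$ is the usual binomial coefficient for $0 \le j \le m$, and $\binom{m}{j} = 0$ if $j < 0$ or $j > m$. *)

theory Defs
  imports Main
begin

text \<open>The binomial coefficient with an integer lower index, vanishing outside 0..m. The lower index
  must not be a natural number, since truncated subtraction would turn negative indices into 0;
  for j > m the value 0 is that of the library's binomial coefficient.\<close>

definition binom :: "nat \<Rightarrow> int \<Rightarrow> int" where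
  "binom m j = (if j < 0 then 0 else int (m choose nat j))"

end

(* With X the indeterminate, (1 + q X)^\<nu> (1 + X)^(n - \<nu>) = ((q - 1) X + (1 + X))^\<nu> (1 + X)^(n - \<nu>).
   Expanding either \<nu>-th power by the binomial theorem and comparing coefficients of X^k gives
   the identity with the terms of index 0 included and without the "- 1" on the left.
   For q = 1 this is Vandermonde's convolution; subtracting that case yields the theorem. *)
theory Submission
  imports Defs "HOL-Computational_Algebra.Polynomial"
begin

lemma coeff_one_plus_X_power: "coeff ([:1, 1:] ^ m) j = int (m choose j)"
proof (cases "j \<le> m")
  case False
  then show ?thesis
    by (simp add: coeff_eq_0 degree_linear_power)
qed (simp add: coeff_linear_poly_power)

text \<open>Multiplication by X^i shifts coefficients by \<open>i\<close>; for \<open>i > k\<close>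
  both sides vanish, the right one through the negative lower index.\<close>

lemma coeff_monom_mult_one_plus_X_power:
  "coeff (monom c i * [:1, 1:] ^ m) k = c * binom m (int k - int i)"
  by (auto simp: coeff_monom_mult coeff_one_plus_X_power binom_def nat_diff_distrib)

text \<open>Keeping \<open>p\<close> abstract covers both expansions: \<open>p\<close> will be 1
  with \<open>f\<close> constant, then 1 + X with \<open>f i = n - i\<close>.\<close>

lemma coeff_binomial_expansion:
  fixes c :: int
  assumes "\<And>i. i \<le> \<nu> \<Longrightarrow> p ^ (\<nu> - i) * [:1, 1:] ^ m = [:1, 1:] ^ f i"
  shows "coeff ((monom c 1 + p) ^ \<nu> * [:1, 1:] ^ m) k =
         (\<Sum>i\<le>\<nu>. c ^ i * binom \<nu> (int i) * binom (f i) (int k - int i))"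
proof -
  have "(monom c 1 + p) ^ \<nu> * [:1, 1:] ^ m =
        (\<Sum>i\<le>\<nu>. monom (c ^ i * binom \<nu> (int i)) i * [:1, 1:] ^ f i)"
    unfolding binomial_ring sum_distrib_right
    by (rule sum.cong)
       (simp_all add: monom_power of_nat_poly binom_def smult_monom_mult mult.assoc assms mult.commute[of "c ^ _"])
  then show ?thesis
    by (simp add: coeff_sum coeff_monom_mult_one_plus_X_power)
qed

text \<open>Holds for every integer \<open>q\<close>, so that it can also be applied at
  \<open>q = 1\<close>.\<close>

lemma sum_power_binom_shift:
  fixes q :: int
  assumes "\<nu> \<le> n"
  shows "(\<Sum>i\<le>\<nu>. q ^ i * binom \<nu> (int i) * binom (n - \<nu>) (int k - int i)) =
         (\<Sum>i\<le>\<nu>. (q - 1) ^ i * binom \<nu> (int i) * binom (n - i) (int k - int i))"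
proof -
  have "(\<Sum>i\<le>\<nu>. q ^ i * binom \<nu> (int i) * binom (n - \<nu>) (int k - int i)) =
        coeff ((monom q 1 + 1) ^ \<nu> * [:1, 1:] ^ (n - \<nu>)) k"
    using assms by (subst coeff_binomial_expansion[where f = "\<lambda>_. n - \<nu>"]) simp_all
  also have "monom q 1 + 1 = monom (q - 1) 1 + [:1, 1:]"
    by (simp add: monom_altdef one_pCons)
  \<comment> \<open>Here (1 + X)^(\<nu> - i) from the expansion merges with (1 + X)^(n - \<nu>) into
    (1 + X)^(n - i).\<close>
  also have "coeff ((monom (q - 1) 1 + [:1, 1:]) ^ \<nu> * [:1, 1:] ^ (n - \<nu>)) k =
             (\<Sum>i\<le>\<nu>. (q - 1) ^ i * binom \<nu> (int i) * binom (n - i) (int k - int i))"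
    using assms by (subst coeff_binomial_expansion[where f = "\<lambda>i. n - i"])
                   (simp_all flip: power_add)
  finally show ?thesis .
qed

theorem mainTheorem4:
  fixes q :: int and n \<nu> k :: nat
  assumes "q \<ge> 2" and "n \<ge> 1" and "1 \<le> \<nu>" and "\<nu> \<le> n" and "k \<le> n"
  shows "(\<Sum>i=1..\<nu>. (q ^ i - 1) * binom \<nu> (int i) * binom (n - \<nu>) (int k - int i)) =
         (\<Sum>i=1..\<nu>. (q - 1) ^ i * binom \<nu> (int i) * binom (n - i) (int k - int i))"
proof -
  let ?L = "\<lambda>r i. r ^ i * binom \<nu> (int i) * binom (n - \<nu>) (int k - int i)"
  let ?R = "\<lambda>r i. (r - 1) ^ i * binom \<nu> (int i) * binom (n - i) (int k - int i)"
  have split: "sum f {..\<nu>} = f 0 + sum f {1..\<nu>}" for f :: "nat \<Rightarrow> int"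
    by (simp add: atMost_atLeast0 sum.atLeast_Suc_atMost)
  have "(\<Sum>i=1..\<nu>. (q ^ i - 1) * binom \<nu> (int i) * binom (n - \<nu>) (int k - int i)) =
        (\<Sum>i=1..\<nu>. ?L q i) - (\<Sum>i=1..\<nu>. ?L 1 i)"
    by (simp add: left_diff_distrib flip: sum_subtractf)
  \<comment> \<open>Since \<open>r ^ 0 = 1\<close> for every \<open>r\<close>, the two terms of
    index 0 cancel.\<close>
  also have "\<dots> = (\<Sum>i\<le>\<nu>. ?L q i) - (\<Sum>i\<le>\<nu>. ?L 1 i)"
    unfolding split by simp
  also have "\<dots> = (\<Sum>i\<le>\<nu>. ?R q i) - (\<Sum>i\<le>\<nu>. ?R 1 i)"
    unfolding sum_power_binom_shift[OF \<open>\<nu> \<le> n\<close>] ..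
  \<comment> \<open>At \<open>r = 1\<close> the factor \<open>0 ^ i\<close> leaves only the term of
    index 0, which cancels that of \<open>?R q\<close>.\<close>
  also have "\<dots> = (\<Sum>i=1..\<nu>. ?R q i)"
    unfolding split by (simp add: power_0_left)
  finally show ?thesis .
qed

end
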